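(* Let $H$ and $H_1,\dots,H_m$ be finite-dimensional Hilbert spaces and let $V_j\in B(H,H_j)$, $j=1,\dots,m$, be such that $\{V_j\}_{j=1}^m$ is a Parseval (OPV)-frame for $H$. Then the only Parseval dual (OPV)-frame for $\{V_j\}_{j=1}^m$ is $\{V_j\}_{j=1}^m$ itself.
   Context: Hilbert spaces are over $\mathbb{R}$ or $\mathbb{C}$. A family $V_j\in B(H,H_j)$, $j=1,\dots,m$, is a Parseval operator-valued frame (Parseval (OPV)-frame) for $H$ if $\sum_{j=1}^m V_j^*V_j=I$. A family $\{W_j\}_{j=1}^m$, $W_j\in B(H,H_j)$, is dual to $\{V_j\}_{j=1}^m$ if $\sum_{j=1}^m W_j^*V_j=I$; a Parseval dual is a dual that is itself a Parseval (OPV)-frame. *)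

theory Defs
  imports
    "HOL-Analysis.Analysis"
    "Jordan_Normal_Form.VS_Connect"
begin

text \<open>
  The class below captures "the reals or the complex numbers": a field that is a real algebra with
  a multiplicative norm extending the absolute value of the reals is isometrically isomorphic to the
  reals or to the complex numbers (Gelfand--Mazur, Ostrowski), and the last axiom determines the
  involution, which is then the identity or complex conjugation.
\<close>

class real_or_complex = conjugatable_field + real_normed_field +
  assumes mult_conjugate: "a * conjugate a = (norm a)\<^sup>2 *\<^sub>R 1"

instance real :: real_or_complex
proof
  show "a * conjugate a = (norm a)\<^sup>2 *\<^sub>R 1" for a :: real
    by (simp add: power2_eq_square)
qed

instance complex :: real_or_complex
proof
  show "a * conjugate a = (norm a)\<^sup>2 *\<^sub>R 1" for a :: complex
    unfolding conjugate_complex_def scaleR_conv_of_real by (metis complex_norm_square mult_1_right of_real_power)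
qed

text \<open>
  Spaces are records with an explicit carrier, so that the members of a finite family of Hilbert
  spaces may have different dimensions; operators only matter on the carrier of their domain.
  The fields \<open>mult\<close> and \<open>one\<close> inherited from the library's module record are
  not used.
\<close>

record ('k, 'v) ip_module = "('k, 'v) module" +
  inner_prod :: "'v \<Rightarrow> 'v \<Rightarrow> 'k"

definition hnorm :: "('k::real_or_complex, 'v) ip_module \<Rightarrow> 'v \<Rightarrow> real" where
  "hnorm H x = sqrt (norm (inner_prod H x x))"

text \<open>The value off the carrier is irrelevant; it is fixed because the library's metric spaces
  require symmetry and nonnegativity of the distance on the whole type.\<close>

definition hdist :: "('k::real_or_complex, 'v) ip_module \<Rightarrow> 'v \<Rightarrow> 'v \<Rightarrow> real" where
  "hdist H x y = (if x \<in> carrier H \<and> y \<in> carrier H then hnorm H (x \<ominus>\<^bsub>H\<^esub> y) else 0)"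

locale hilbert_space = vectorspace class_ring H
  for H :: "('k::real_or_complex, 'v) ip_module" (structure) +
  assumes inner_prod_add: "\<lbrakk>x \<in> carrier H; y \<in> carrier H; z \<in> carrier H\<rbrakk>
      \<Longrightarrow> inner_prod H (x \<oplus> y) z = inner_prod H x z + inner_prod H y z"
    and inner_prod_smult: "\<lbrakk>x \<in> carrier H; y \<in> carrier H\<rbrakk>
      \<Longrightarrow> inner_prod H (a \<odot> x) y = a * inner_prod H x y"
    and inner_prod_conjugate: "\<lbrakk>x \<in> carrier H; y \<in> carrier H\<rbrakk>
      \<Longrightarrow> inner_prod H y x = conjugate (inner_prod H x y)"
    and inner_prod_nonneg: "x \<in> carrier H \<Longrightarrow> \<exists>r\<ge>0. inner_prod H x x = of_real r"
    and inner_prod_definite: "\<lbrakk>x \<in> carrier H; inner_prod H x x = 0\<rbrakk> \<Longrightarrow> x = \<zero>"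
    and complete: "Metric_space.mcomplete (carrier H) (hdist H)"

locale fin_dim_hilbert_space = hilbert_space +
  assumes finite_dimensional: "fin_dim"

definition bounded_operators ::
  "('k::real_or_complex, 'v) ip_module \<Rightarrow> ('k, 'w) ip_module \<Rightarrow> ('v \<Rightarrow> 'w) set" where
  "bounded_operators H K =
    {T \<in> module_hom class_ring H K. \<exists>C. \<forall>x\<in>carrier H. hnorm K (T x) \<le> C * hnorm H x}"

text \<open>Between Hilbert spaces, the defining property determines the adjoint on the carrier of the
  codomain \<open>K\<close>.\<close>

definition op_adjoint ::
  "('k::real_or_complex, 'v) ip_module \<Rightarrow> ('k, 'w) ip_module \<Rightarrow> ('v \<Rightarrow> 'w) \<Rightarrow> 'w \<Rightarrow> 'v" where
  "op_adjoint H K T = (SOME S. S \<in> bounded_operators K H \<and>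
    (\<forall>x\<in>carrier H. \<forall>y\<in>carrier K. inner_prod K (T x) y = inner_prod H x (S y)))"

definition parseval_frame ::
  "nat \<Rightarrow> ('k::real_or_complex, 'v) ip_module \<Rightarrow> (nat \<Rightarrow> ('k, 'w) ip_module)
    \<Rightarrow> (nat \<Rightarrow> 'v \<Rightarrow> 'w) \<Rightarrow> bool" where
  "parseval_frame m H K V \<longleftrightarrow>
    (\<forall>j\<in>{1..m}. V j \<in> bounded_operators H (K j)) \<and>
    (\<forall>x\<in>carrier H. (\<Oplus>\<^bsub>H\<^esub>j\<in>{1..m}. op_adjoint H (K j) (V j) (V j x)) = x)"

definition dual_family ::
  "nat \<Rightarrow> ('k::real_or_complex, 'v) ip_module \<Rightarrow> (nat \<Rightarrow> ('k, 'w) ip_module)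
    \<Rightarrow> (nat \<Rightarrow> 'v \<Rightarrow> 'w) \<Rightarrow> (nat \<Rightarrow> 'v \<Rightarrow> 'w) \<Rightarrow> bool" where
  "dual_family m H K V W \<longleftrightarrow>
    (\<forall>j\<in>{1..m}. W j \<in> bounded_operators H (K j)) \<and>
    (\<forall>x\<in>carrier H. (\<Oplus>\<^bsub>H\<^esub>j\<in>{1..m}. op_adjoint H (K j) (W j) (V j x)) = x)"

definition parseval_dual ::
  "nat \<Rightarrow> ('k::real_or_complex, 'v) ip_module \<Rightarrow> (nat \<Rightarrow> ('k, 'w) ip_module)
    \<Rightarrow> (nat \<Rightarrow> 'v \<Rightarrow> 'w) \<Rightarrow> (nat \<Rightarrow> 'v \<Rightarrow> 'w) \<Rightarrow> bool" where
  "parseval_dual m H K V W \<longleftrightarrow> dual_family m H K V W \<and> parseval_frame m H K W"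

end

theory Submission
  imports Defs
begin

text \<open>
  If \<open>A\<close> is dual to \<open>B\<close>, then \<open>\<Sum>\<^sub>j \<langle>A\<^sub>j x, B\<^sub>j x\<rangle> = \<langle>x, x\<rangle>\<close>.  For a Parseval dual \<open>W\<close> of the Parseval
  frame \<open>V\<close> this applies to all four terms of the expansion of \<open>\<Sum>\<^sub>j \<parallel>W\<^sub>j x - V\<^sub>j x\<parallel>\<^sup>2\<close>, which therefore
  vanishes.  Since the adjoint is a choice, its existence has to be shown first; this is where finite
  dimension enters, through the Riesz representation of linear functionals.
\<close>

section \<open>Algebra of the inner product and its norm\<close>

context hilbert_space
begin

lemma smult_closed' [simp, intro]: "x \<in> carrier H \<Longrightarrow> a \<odot> x \<in> carrier H"
  by (rule smult_closed) simp_all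

lemma inner_prod_zero_left [simp]: "y \<in> carrier H \<Longrightarrow> inner_prod H \<zero> y = 0"
  using inner_prod_add[of \<zero> \<zero> y] by simp

lemma inner_prod_zero_right [simp]: "y \<in> carrier H \<Longrightarrow> inner_prod H y \<zero> = 0"
  using inner_prod_conjugate[of \<zero> y] by simp

lemma inner_prod_add_right:
  assumes "x \<in> carrier H" "y \<in> carrier H" "z \<in> carrier H"
  shows "inner_prod H x (y \<oplus> z) = inner_prod H x y + inner_prod H x z"
proof -
  have "inner_prod H x (y \<oplus> z) = conjugate (inner_prod H (y \<oplus> z) x)"
    using assms by (intro inner_prod_conjugate) auto
  also have "\<dots> = conjugate (inner_prod H y x) + conjugate (inner_prod H z x)"
    using assms by (simp add: inner_prod_add conjugate_dist_add)
  also have "\<dots> = inner_prod H x y + inner_prod H x z"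
    using assms inner_prod_conjugate by metis
  finally show ?thesis .
qed

lemma inner_prod_smult_right:
  assumes "x \<in> carrier H" "y \<in> carrier H"
  shows "inner_prod H x (a \<odot> y) = conjugate a * inner_prod H x y"
proof -
  have "inner_prod H x (a \<odot> y) = conjugate (inner_prod H (a \<odot> y) x)"
    using assms by (intro inner_prod_conjugate) auto
  also have "\<dots> = conjugate a * conjugate (inner_prod H y x)"
    using assms by (simp add: inner_prod_smult conjugate_dist_mul)
  also have "\<dots> = conjugate a * inner_prod H x y"
    using assms inner_prod_conjugate by metis
  finally show ?thesis .
qed

lemma inner_prod_diff_left:
  assumes "x \<in> carrier H" "y \<in> carrier H" "z \<in> carrier H"
  shows "inner_prod H (x \<ominus> y) z = inner_prod H x z - inner_prod H y z"
proof -
  have "inner_prod H ((x \<ominus> y) \<oplus> y) z = inner_prod H (x \<ominus> y) z + inner_prod H y z"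
    using assms by (intro inner_prod_add) auto
  moreover have "(x \<ominus> y) \<oplus> y = x"
    using assms by (simp add: a_minus_def M.a_assoc M.l_neg)
  ultimately show ?thesis by simp
qed

lemma inner_prod_diff_right:
  assumes "x \<in> carrier H" "y \<in> carrier H" "z \<in> carrier H"
  shows "inner_prod H x (y \<ominus> z) = inner_prod H x y - inner_prod H x z"
proof -
  have "inner_prod H x ((y \<ominus> z) \<oplus> z) = inner_prod H x (y \<ominus> z) + inner_prod H x z"
    using assms by (intro inner_prod_add_right) auto
  moreover have "(y \<ominus> z) \<oplus> z = y"
    using assms by (simp add: a_minus_def M.a_assoc M.l_neg)
  ultimately show ?thesis by simp
qed

lemma inner_prod_finsum_right:
  assumes "finite A" "x \<in> carrier H" "g \<in> A \<rightarrow> carrier H"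
  shows "inner_prod H x (\<Oplus>a\<in>A. g a) = (\<Sum>a\<in>A. inner_prod H x (g a))"
  using assms
proof (induction A rule: finite_induct)
  case (insert a A)
  then show ?case
    by (subst M.finsum_insert) (auto simp: inner_prod_add_right Pi_def)
qed simp

text \<open>\<open>hnorm\<close> only sees the modulus of \<open>inner_prod H x x\<close>; the axiom
  \<open>inner_prod_nonneg\<close> makes this value a nonnegative real, so nothing is lost by taking
  the modulus.\<close>

lemma inner_prod_self: "x \<in> carrier H \<Longrightarrow> inner_prod H x x = of_real ((hnorm H x)\<^sup>2)"
  using inner_prod_nonneg[of x] by (auto simp: hnorm_def)

lemma hnorm_nonneg [simp]: "0 \<le> hnorm H x"
  by (simp add: hnorm_def)

lemma hnorm_eq_0_iff: "x \<in> carrier H \<Longrightarrow> hnorm H x = 0 \<longleftrightarrow> x = \<zero>"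
  using inner_prod_self[of x] inner_prod_definite[of x] by (auto simp: hnorm_def)

text \<open>Testing against \<open>y \<ominus> z\<close> itself gives a vector of norm zero. This
  later turns linearity of an adjoint into an identity between inner products.\<close>

lemma eq_if_inner_prod_eq:
  assumes "y \<in> carrier H" "z \<in> carrier H"
    and "\<And>x. x \<in> carrier H \<Longrightarrow> inner_prod H x y = inner_prod H x z"
  shows "y = z"
proof -
  have "inner_prod H (y \<ominus> z) (y \<ominus> z) = 0"
    using assms by (simp add: inner_prod_diff_right)
  then have "y \<ominus> z = \<zero>"
    using assms by (intro inner_prod_definite) auto
  then show ?thesis
    using assms by simp
qed

text \<open>The part \<open>u\<close> of \<open>x\<close> orthogonal to \<open>y\<close> has a
  nonnegative squared norm, and computing that norm gives the inequality.\<close>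

lemma Cauchy_Schwarz:
  assumes x: "x \<in> carrier H" and y: "y \<in> carrier H"
  shows "norm (inner_prod H x y) \<le> hnorm H x * hnorm H y"
proof (cases "y = \<zero>")
  case True
  then show ?thesis using x by simp
next
  case False
  then have pos: "0 < hnorm H y"
    using y hnorm_eq_0_iff[of y] hnorm_nonneg[of y] by linarith
  \<comment> \<open>The coefficient of the orthogonal projection of \<open>x\<close> onto the line
    through \<open>y\<close>.\<close>
  define a where "a = inner_prod H x y / inner_prod H y y"
  define u where "u = x \<ominus> a \<odot> y"
  have u: "u \<in> carrier H"
    using x y by (simp add: u_def)
  have "inner_prod H y y \<noteq> 0"
    using y False inner_prod_definite by blast
  then have "inner_prod H u y = 0"
    using x y by (simp add: u_def a_def inner_prod_diff_left inner_prod_smult)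
  \<comment> \<open>Only the second argument is expanded: its component along \<open>y\<close> is
    orthogonal to \<open>u\<close> and drops out.\<close>
  then have "inner_prod H u u = inner_prod H u x"
    using x y u by (subst (2) u_def) (simp add: inner_prod_diff_right inner_prod_smult_right)
  also have "\<dots> = inner_prod H x x - a * inner_prod H y x"
    using x y by (simp add: u_def inner_prod_diff_left inner_prod_smult)
  also have "inner_prod H y x = conjugate (inner_prod H x y)"
    using x y by (rule inner_prod_conjugate)
  also have "a * conjugate (inner_prod H x y) =
      inner_prod H x y * conjugate (inner_prod H x y) / inner_prod H y y"
    by (simp add: a_def)
  finally have "(of_real ((hnorm H u)\<^sup>2) :: 'k) =
      of_real ((hnorm H x)\<^sup>2 - (norm (inner_prod H x y))\<^sup>2 / (hnorm H y)\<^sup>2)"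
    using x y u by (simp add: inner_prod_self mult_conjugate scaleR_conv_of_real)
  then have "(hnorm H u)\<^sup>2 = (hnorm H x)\<^sup>2 - (norm (inner_prod H x y))\<^sup>2 / (hnorm H y)\<^sup>2"
    by (simp only: of_real_eq_iff)
  then have "(norm (inner_prod H x y))\<^sup>2 / (hnorm H y)\<^sup>2 \<le> (hnorm H x)\<^sup>2"
    by (metis diff_ge_0_iff_ge zero_le_power2)
  then have "(norm (inner_prod H x y))\<^sup>2 \<le> (hnorm H x * hnorm H y)\<^sup>2"
    using pos by (simp add: field_simps power_mult_distrib)
  then show ?thesis
    by (rule power2_le_imp_le) simp
qed

section \<open>Riesz representation of linear functionals\<close>

lemma submodule_representable:
  assumes z: "z \<in> carrier H"
    and add: "\<And>x y. x \<in> carrier H \<Longrightarrow> y \<in> carrier H \<Longrightarrow> f (x \<oplus> y) = f x + f y"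
    and smult: "\<And>a x. x \<in> carrier H \<Longrightarrow> f (a \<odot> x) = a * f x"
  shows "LinearCombinations.submodule class_ring {x \<in> carrier H. f x = inner_prod H x z} H"
proof (unfold_locales, goal_cases)
  case 3
  have "f \<zero> = 0"
    using add[of \<zero> \<zero>] by simp
  then show ?case using z by simp
qed (use z in \<open>auto simp: add smult inner_prod_add inner_prod_smult\<close>)

text \<open>A Gram-Schmidt argument by induction on the generators: a representing vector on the
  smaller span is corrected by a multiple of a vector orthogonal to that span, so that the value at
  the new generator also comes out right.\<close>

lemma Riesz_on_span:
  assumes "finite B" "B \<subseteq> carrier H"
    and add: "\<And>x y. x \<in> carrier H \<Longrightarrow> y \<in> carrier H \<Longrightarrow> f (x \<oplus> y) = f x + f y"
    and smult: "\<And>a x. x \<in> carrier H \<Longrightarrow> f (a \<odot> x) = a * f x"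
  shows "\<exists>z\<in>span B. \<forall>x\<in>span B. f x = inner_prod H x z"
  using assms
\<comment> \<open>The functional is generalized because the induction hypothesis is applied twice,
  to \<open>f\<close> and to the inner product with the new generator.\<close>
proof (induction B arbitrary: f rule: finite_induct)
  case (empty f)
  have "f \<zero> = 0"
    using empty(2)[of \<zero> \<zero>] by simp
  then show ?case
    by (auto simp: span_empty)
next
  case (insert b B f)
  let ?S = "span (insert b B)"
  have B: "B \<subseteq> carrier H" and b: "b \<in> carrier H"
    using insert.prems by auto
  interpret S: LinearCombinations.submodule class_ring ?S H
    using insert.prems(1) by (rule span_is_submodule)
  have BS: "span B \<subseteq> ?S"
    by (rule span_is_monotone) auto
  have bS: "b \<in> ?S"
    using in_own_span[OF insert.prems(1)] by auto
  obtain z where z: "z \<in> span B" and fz: "\<And>x. x \<in> span B \<Longrightarrow> f x = inner_prod H x z"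
    using insert.IH[OF B insert.prems(2,3)] by blast
  \<comment> \<open>The vector representing the inner product with \<open>b\<close> is the
    orthogonal projection of \<open>b\<close> onto \<open>span B\<close>, so no separate projection
    theorem is required.\<close>
  have "\<exists>p\<in>span B. \<forall>x\<in>span B. inner_prod H x b = inner_prod H x p"
    using insert.IH[OF B, of "\<lambda>x. inner_prod H x b"] b by (simp add: inner_prod_add inner_prod_smult)
  then obtain p where p: "p \<in> span B"
    and bp: "\<And>x. x \<in> span B \<Longrightarrow> inner_prod H x b = inner_prod H x p"
    by blast
  define u where "u = b \<ominus> p"
  have zH: "z \<in> carrier H" and pH: "p \<in> carrier H"
    using z p span_is_subset2[OF B] by auto
  have uH: "u \<in> carrier H"
    using b pH by (simp add: u_def)
  have "(- 1 :: 'k) \<odot> p \<in> ?S"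
    using p BS by (intro S.smult_closed) auto
  moreover have "(- 1 :: 'k) \<odot> p = \<ominus> p"
    using smult_minus_1[OF pH] by (simp add: class_ring_simps)
  ultimately have uS: "u \<in> ?S"
    unfolding u_def a_minus_def using bS by auto
  have orth: "inner_prod H x u = 0" if "x \<in> span B" for x
  proof -
    have "x \<in> carrier H" using that span_is_subset2[OF B] by auto
    then show ?thesis
      using bp[OF that] b pH by (simp add: u_def inner_prod_diff_right)
  qed
  \<comment> \<open>The form is conjugate-linear in its second argument, so the conjugate here
    cancels in \<open>inner_prod H x w\<close>. Since
    \<open>inner_prod H b u = inner_prod H u u\<close>, the quotient adds exactly the missing amount
    at \<open>b\<close>. If \<open>u\<close> is zero, division by zero gives
    \<open>c = 0\<close>.\<close>
  define c where "c = conjugate ((f b - inner_prod H b z) / inner_prod H u u)"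
  define w where "w = z \<oplus> c \<odot> u"
  have wS: "w \<in> ?S"
    unfolding w_def using z BS uS by auto
  have wH: "w \<in> carrier H"
    using zH uH by (simp add: w_def)
  have w: "inner_prod H x w = inner_prod H x z +
      (f b - inner_prod H b z) / inner_prod H u u * inner_prod H x u" if "x \<in> carrier H" for x
    using that zH uH by (simp add: w_def c_def inner_prod_add_right inner_prod_smult_right)
  have fB: "f x = inner_prod H x w" if "x \<in> span B" for x
  proof -
    have "x \<in> carrier H" using that span_is_subset2[OF B] by auto
    then show ?thesis using w orth[OF that] fz[OF that] by simp
  qed
  have fb: "f b = inner_prod H b w"
  proof (cases "u = \<zero>")
    case True
    \<comment> \<open>The new generator already lies in \<open>span B\<close>, where
      \<open>f\<close> is known to be represented by \<open>w\<close>.\<close>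
    then have "b = p" using b pH by (simp add: u_def)
    then show ?thesis using fB[OF p] by simp
  next
    case False
    then have nz: "inner_prod H u u \<noteq> 0"
      using inner_prod_definite uH by blast
    have "inner_prod H u u = inner_prod H b u"
      using orth[OF p] b pH uH by (subst (1) u_def) (simp add: inner_prod_diff_left)
    then show ?thesis
      using nz w[OF b] by simp
  qed
  \<comment> \<open>The vectors at which \<open>w\<close> represents \<open>f\<close> form a
    submodule; it contains the generators, hence their span.\<close>
  have "?S \<subseteq> {x \<in> carrier H. f x = inner_prod H x w}"
  proof (rule span_is_subset)
    show "insert b B \<subseteq> {x \<in> carrier H. f x = inner_prod H x w}"
      using b B fb fB in_own_span[OF B] by auto
  qed (rule submodule_representable[OF wH insert.prems(2,3)])
  then show ?case
    using wS by auto
qed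

end

text \<open>Finite dimension supplies a finite generating set, whose span is the whole
  carrier.\<close>

lemma (in fin_dim_hilbert_space) Riesz_representation:
  assumes "\<And>x y. x \<in> carrier H \<Longrightarrow> y \<in> carrier H \<Longrightarrow> f (x \<oplus> y) = f x + f y"
    and "\<And>a x. x \<in> carrier H \<Longrightarrow> f (a \<odot> x) = a * f x"
  shows "\<exists>z\<in>carrier H. \<forall>x\<in>carrier H. f x = inner_prod H x z"
proof -
  obtain B where "finite B" "B \<subseteq> carrier H" "span B = carrier H"
    using finite_dimensional unfolding fin_dim_def by blast
  then show ?thesis
    using Riesz_on_span[of B f] assms by simp
qed

section \<open>Existence and properties of adjoints\<close>

locale hilbert_space_pair =
  H: hilbert_space H + K: hilbert_space K
  for H :: "('k::real_or_complex, 'v) ip_module" and K :: "('k, 'w) ip_module"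
begin

lemma bounded_operator_closed:
  "T \<in> bounded_operators H K \<Longrightarrow> x \<in> carrier H \<Longrightarrow> T x \<in> carrier K"
  by (auto simp: bounded_operators_def module_hom_def)

text \<open>The adjoint relation alone forces linearity, because inner products separate vectors,
  and it carries the bound of \<open>T\<close> over to \<open>S\<close>.\<close>

lemma adjoint_in_bounded_operators:
  assumes T: "T \<in> bounded_operators H K"
    and S: "\<And>y. y \<in> carrier K \<Longrightarrow> S y \<in> carrier H"
    and adj: "\<And>x y. x \<in> carrier H \<Longrightarrow> y \<in> carrier K \<Longrightarrow> inner_prod K (T x) y = inner_prod H x (S y)"
  shows "S \<in> bounded_operators K H"
proof -
  have TK: "T x \<in> carrier K" if "x \<in> carrier H" for x
    using T that by (rule bounded_operator_closed)
  have add: "S (y \<oplus>\<^bsub>K\<^esub> z) = S y \<oplus>\<^bsub>H\<^esub> S z" if "y \<in> carrier K" "z \<in> carrier K" for y z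
    using that S by (intro H.eq_if_inner_prod_eq)
      (auto simp: adj[symmetric] TK K.inner_prod_add_right H.inner_prod_add_right)
  have smult: "S (a \<odot>\<^bsub>K\<^esub> y) = a \<odot>\<^bsub>H\<^esub> S y" if "y \<in> carrier K" for a y
    using that S by (intro H.eq_if_inner_prod_eq)
      (auto simp: adj[symmetric] TK K.inner_prod_smult_right H.inner_prod_smult_right)
  obtain C where C: "\<And>x. x \<in> carrier H \<Longrightarrow> hnorm K (T x) \<le> C * hnorm H x"
    using T by (auto simp: bounded_operators_def)
  \<comment> \<open>The sign of \<open>C\<close> is not known, hence the absolute value. Unless
    \<open>S y\<close> has norm zero, \<open>inner_prod K (T (S y)) y\<close> equals its squared
    norm, and one factor cancels after Cauchy-Schwarz.\<close>
  have "hnorm H (S y) \<le> \<bar>C\<bar> * hnorm K y" if y: "y \<in> carrier K" for y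
  proof (cases "hnorm H (S y) = 0")
    case True
    then show ?thesis by simp
  next
    case False
    then have pos: "0 < hnorm H (S y)"
      using H.hnorm_nonneg[of "S y"] by linarith
    have "(hnorm H (S y))\<^sup>2 = norm (inner_prod K (T (S y)) y)"
      using S[OF y] y by (simp add: adj hnorm_def)
    also have "\<dots> \<le> hnorm K (T (S y)) * hnorm K y"
      using S[OF y] y by (intro K.Cauchy_Schwarz TK)
    also have "\<dots> \<le> (\<bar>C\<bar> * hnorm H (S y)) * hnorm K y"
      using C[OF S[OF y]] mult_right_mono[OF abs_ge_self[of C] H.hnorm_nonneg[of "S y"]]
      by (intro mult_right_mono) auto
    finally show ?thesis
      using pos by (simp add: power2_eq_square field_simps)
  qed
  then show ?thesis
    using S add smult by (auto simp: bounded_operators_def module_hom_def)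
qed

end

locale fin_dim_hilbert_space_pair =
  hilbert_space_pair H K + H: fin_dim_hilbert_space H
  for H :: "('k::real_or_complex, 'v) ip_module" and K :: "('k, 'w) ip_module"
begin

text \<open>For each fixed \<open>y\<close>, the functional sending \<open>x\<close> to
  \<open>inner_prod K (T x) y\<close> is linear; choosing a Riesz vector for every \<open>y\<close>
  defines \<open>S\<close>.\<close>

lemma adjoint_exists:
  assumes T: "T \<in> bounded_operators H K"
  shows "\<exists>S. S \<in> bounded_operators K H \<and>
    (\<forall>x\<in>carrier H. \<forall>y\<in>carrier K. inner_prod K (T x) y = inner_prod H x (S y))"
proof -
  have "\<exists>z\<in>carrier H. \<forall>x\<in>carrier H. inner_prod K (T x) y = inner_prod H x z"
    if "y \<in> carrier K" for y
    using T that by (intro H.Riesz_representation)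
      (auto simp: bounded_operators_def module_hom_def K.inner_prod_add K.inner_prod_smult Pi_def)
  then obtain S where "\<And>y. y \<in> carrier K \<Longrightarrow> S y \<in> carrier H"
    "\<And>x y. x \<in> carrier H \<Longrightarrow> y \<in> carrier K \<Longrightarrow> inner_prod K (T x) y = inner_prod H x (S y)"
    by metis
  then show ?thesis
    using adjoint_in_bounded_operators[OF T] by blast
qed

text \<open>Existence guarantees that the choice in \<open>op_adjoint\<close> meets its
  specification.\<close>

lemma
  assumes "T \<in> bounded_operators H K"
  shows op_adjoint_closed: "y \<in> carrier K \<Longrightarrow> op_adjoint H K T y \<in> carrier H"
    and inner_prod_op_adjoint: "x \<in> carrier H \<Longrightarrow> y \<in> carrier K \<Longrightarrow>
      inner_prod H x (op_adjoint H K T y) = inner_prod K (T x) y"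
  using someI_ex[OF adjoint_exists[OF assms], folded op_adjoint_def]
  by (auto simp: bounded_operators_def module_hom_def)

end

section \<open>Parseval frames and their duals\<close>

lemma dual_family_self: "parseval_frame m H K V \<Longrightarrow> dual_family m H K V V"
  by (simp add: parseval_frame_def dual_family_def)

text \<open>Pair the reconstruction formula for \<open>x\<close> with \<open>x\<close> itself and
  move every adjoint to the other side.\<close>

lemma dual_family_inner_prod_sum:
  assumes H: "fin_dim_hilbert_space H"
    and K: "\<And>j. j \<in> {1..m} \<Longrightarrow> fin_dim_hilbert_space (K j)"
    and V: "\<And>j. j \<in> {1..m} \<Longrightarrow> V j \<in> bounded_operators H (K j)"
    and dual: "dual_family m H K V W"
    and x: "x \<in> carrier H"
  shows "(\<Sum>j\<in>{1..m}. inner_prod (K j) (W j x) (V j x)) = inner_prod H x x"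
proof -
  interpret H: fin_dim_hilbert_space H by (rule H)
  have pair: "fin_dim_hilbert_space_pair H (K j)" if "j \<in> {1..m}" for j
    using H K[OF that]
    by (simp add: fin_dim_hilbert_space_pair_def hilbert_space_pair_def fin_dim_hilbert_space_def)
  have W: "W j \<in> bounded_operators H (K j)" if "j \<in> {1..m}" for j
    using dual that by (simp add: dual_family_def)
  have VK: "V j x \<in> carrier (K j)" if "j \<in> {1..m}" for j
    using V[OF that] x by (auto simp: bounded_operators_def module_hom_def)
  have "inner_prod H x x = inner_prod H x (\<Oplus>\<^bsub>H\<^esub>j\<in>{1..m}. op_adjoint H (K j) (W j) (V j x))"
    using dual x by (simp add: dual_family_def)
  also have "\<dots> = (\<Sum>j\<in>{1..m}. inner_prod H x (op_adjoint H (K j) (W j) (V j x)))"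
    using x fin_dim_hilbert_space_pair.op_adjoint_closed[OF pair W VK]
    by (intro H.inner_prod_finsum_right) auto
  also have "\<dots> = (\<Sum>j\<in>{1..m}. inner_prod (K j) (W j x) (V j x))"
    using fin_dim_hilbert_space_pair.inner_prod_op_adjoint[OF pair W x VK]
    by (intro sum.cong) auto
  finally show ?thesis by simp
qed

text \<open>Families are compared on \<open>carrier H\<close> only, since membership in
  \<open>bounded_operators\<close> leaves the values elsewhere arbitrary.\<close>

theorem proposition10:
  fixes H :: "('k::real_or_complex, 'v) ip_module"
    and K :: "nat \<Rightarrow> ('k, 'w) ip_module"
    and V :: "nat \<Rightarrow> 'v \<Rightarrow> 'w"
    and m :: nat
  assumes "fin_dim_hilbert_space H"
    and "\<forall>j\<in>{1..m}. fin_dim_hilbert_space (K j)"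
    and "\<forall>j\<in>{1..m}. V j \<in> bounded_operators H (K j)"
    and "parseval_frame m H K V"
  shows "parseval_dual m H K V V \<and>
    (\<forall>W. parseval_dual m H K V W \<longrightarrow> (\<forall>j\<in>{1..m}. \<forall>x\<in>carrier H. W j x = V j x))"
proof (intro conjI allI impI ballI)
  show "parseval_dual m H K V V"
    using assms(4) dual_family_self by (auto simp: parseval_dual_def)
next
  fix W j x
  assume "parseval_dual m H K V W" and j: "j \<in> {1..m}" and x: "x \<in> carrier H"
  then have dual: "dual_family m H K V W" and pW: "parseval_frame m H K W"
    by (auto simp: parseval_dual_def)
  have fK: "fin_dim_hilbert_space (K i)" if "i \<in> {1..m}" for i
    using assms(2) that by blast
  have K: "hilbert_space (K i)" if "i \<in> {1..m}" for i
    using fK[OF that] by (simp add: fin_dim_hilbert_space_def)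
  have V: "V i \<in> bounded_operators H (K i)" and W: "W i \<in> bounded_operators H (K i)"
    if "i \<in> {1..m}" for i
    using assms(3) pW that by (auto simp: parseval_frame_def)
  have Vx: "V i x \<in> carrier (K i)" and Wx: "W i x \<in> carrier (K i)" if "i \<in> {1..m}" for i
    using V[OF that] W[OF that] x by (auto simp: bounded_operators_def module_hom_def)
  note inner_sum = dual_family_inner_prod_sum[OF assms(1) _ _ _ x]
  \<comment> \<open>The two diagonal sums use that a Parseval frame is dual to itself.\<close>
  have VV: "(\<Sum>i\<in>{1..m}. inner_prod (K i) (V i x) (V i x)) = inner_prod H x x"
    by (intro inner_sum fK V dual_family_self assms(4))
  have WW: "(\<Sum>i\<in>{1..m}. inner_prod (K i) (W i x) (W i x)) = inner_prod H x x"
    by (intro inner_sum fK W dual_family_self pW)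
  have WV: "(\<Sum>i\<in>{1..m}. inner_prod (K i) (W i x) (V i x)) = inner_prod H x x"
    by (intro inner_sum fK V dual)
  \<comment> \<open>Duality is only given with \<open>W\<close> as the adjoint family; the opposite
    mixed sum is the conjugate, and \<open>inner_prod H x x\<close> is its own conjugate.\<close>
  have "(\<Sum>i\<in>{1..m}. inner_prod (K i) (V i x) (W i x)) =
      conjugate (\<Sum>i\<in>{1..m}. inner_prod (K i) (W i x) (V i x))"
    using hilbert_space.inner_prod_conjugate[OF K Wx Vx] by (simp add: sum_conjugate)
  also have "\<dots> = inner_prod H x x"
    unfolding WV using assms(1) x
    by (simp add: fin_dim_hilbert_space_def hilbert_space.inner_prod_conjugate[symmetric])
  finally have VW: "(\<Sum>i\<in>{1..m}. inner_prod (K i) (V i x) (W i x)) = inner_prod H x x" .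
  define d where "d i = W i x \<ominus>\<^bsub>K i\<^esub> V i x" for i
  have d: "d i \<in> carrier (K i)"
    and dd: "inner_prod (K i) (d i) (d i) =
      (inner_prod (K i) (W i x) (W i x) - inner_prod (K i) (W i x) (V i x)) -
      (inner_prod (K i) (V i x) (W i x) - inner_prod (K i) (V i x) (V i x))"
    if "i \<in> {1..m}" for i
  proof -
    interpret hilbert_space "K i" using K[OF that] .
    show "d i \<in> carrier (K i)"
      using Vx[OF that] Wx[OF that] by (simp add: d_def)
    show "inner_prod (K i) (d i) (d i) =
      (inner_prod (K i) (W i x) (W i x) - inner_prod (K i) (W i x) (V i x)) -
      (inner_prod (K i) (V i x) (W i x) - inner_prod (K i) (V i x) (V i x))"
      using Vx[OF that] Wx[OF that]
      by (simp add: d_def inner_prod_diff_left inner_prod_diff_right)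
  qed
  \<comment> \<open>The scalars carry no order here, so the vanishing sum is pulled back to the
    reals, where a zero sum of squares makes each term zero.\<close>
  have "(of_real (\<Sum>i\<in>{1..m}. (hnorm (K i) (d i))\<^sup>2) :: 'k) =
      (\<Sum>i\<in>{1..m}. inner_prod (K i) (d i) (d i))"
    using hilbert_space.inner_prod_self[OF K d] by simp
  also have "\<dots> = 0"
    using VV WW WV VW by (simp add: dd sum_subtractf)
  finally have "(\<Sum>i\<in>{1..m}. (hnorm (K i) (d i))\<^sup>2) = 0"
    by (simp only: of_real_eq_0_iff)
  then have "hnorm (K j) (d j) = 0"
    using j by (subst (asm) sum_nonneg_eq_0_iff) auto
  then have zero: "d j = \<zero>\<^bsub>K j\<^esub>"
    using hilbert_space.hnorm_eq_0_iff[OF K[OF j] d[OF j]] by blast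
  interpret hilbert_space "K j" using K[OF j] .
  show "W j x = V j x"
    using zero Vx[OF j] Wx[OF j] by (simp add: d_def)
qed

end
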